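(* If $C \twoheadrightarrow p_0\cdot(\omega_0,\checkmark) + \sum_k p_k\cdot(\omega_k, C_k)$ then there exists a maximal configuration $x_0$ of $[\![C]\!]$ having a covering chain $\emptyset\subset x_1\subset\cdots\subset x_n=x_0$ whose sequence of added events (read through their labels) is $\omega_0$, and $p_0 = v(x_0)$, where $v$ is the configuration-valuation of $[\![C]\!]$.
   Context: Commands: $C ::= \mathtt{skip} \mid a\in Act \mid C;C \mid C \oplus_p C \mid C\parallel C$ with $p\in(0,1)$. Labels are $Act\cup\{sk\}\cup\{\tau\}$ ($\tau$ an invisible step). Small steps go from a command to a finite probability distribution over pairs (label, command or $\checkmark$): $\mathtt{skip}\to 1\cdot(sk,\checkmark)$, $a\to 1\cdot(a,\checkmark)$, $C_1\oplus_p C_2\to p\cdot(\tau,C_1)+(1-p)\cdot(\tau,C_2)$; for $C_1;C_2$: if $C_1\to1\cdot(l,\checkmark)$ then $C_1;C_2\to1\cdot(l,C_2)$, if $C_1\to 1\cdot(l,C_1')$ then $C_1;C_2\to 1\cdot(l,C_1';C_2)$, if $C_1\to\sum_i p_i(\tau,C_i)$ then $C_1;C_2\to\sum_i p_i(\tau,C_i;C_2)$; $C_1\parallel C_2$ analogously lets either side move (a side that reaches $\checkmark$ is removed). The multi-step relation: if $C\to\sum_i p_i(l,C_i)$ then $C\twoheadrightarrow\sum_i p_i(l,C_i)$; and if moreover each $C_i\twoheadrightarrow\sum_j p_j(\omega_{ij},C_{ij})$ then $C\twoheadrightarrow\sum_i p_i\sum_j p_j(l:\omega_{ij},C_{ij})$.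 A probabilistic event structure is an event structure $(E,\le,\#)$ (partial order with finite down-closures, hereditary irreflexive symmetric conflict; configurations are conflict-free down-closed sets) with a valuation $v$ on finite configurations, $v(\emptyset)=1$, satisfying $v(y)-\sum_{\emptyset\ne I\subseteq\{1..n\}}(-1)^{|I|+1}v(\bigcup_{i\in I}x_i)\ge0$ for $y\subseteq x_1,\dots,x_n$ ($v=0$ on non-configurations). Interpretation $[\![C]\!]$: $[\![\mathtt{skip}]\!]$, $[\![a]\!]$ are one-event structures with valuation 1; $[\![C_1;C_2]\!]$ has events $E_1\uplus(E_2\times$ maximal configurations of $[\![C_1]\!])$ with $e_1\le(e_2,x)$ for $e_1\in x$, and $v(x)=v_1(x)$ on configurations of $[\![C_1]\!]$, $v(x_1\cup(x_2\times\{x_1\}))=v_1(x_1)v_2(x_2)$; $[\![C_1\oplus_p C_2]\!]$ adds an initial event $\tau$ below everything, puts all events of the two sides in mutual conflict, and $v(x)=p\,v_1(x\setminus\tau)$ or $(1-p)v_2(x\setminus\tau)$, with $v(\emptyset)=v(\{\tau\})=1$; $[\![C_1\parallel C_2]\!]$ is the disjoint union with $v(x)=v_1(x\cap E_1)v_2(x\cap E_2)$. A covering chain of $x$ is a chain $\emptyset\subset x_1\subset\cdots\subset x_n=x$ of configurations each adding one event; events carry labels. *)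

theory Defs
  imports Complex_Main "HOL-Library.Multiset" "HOL-Library.FSet"
begin

section \<open>Commands and their operational semantics\<close>

typedef open_prob = "{p :: real. 0 < p \<and> p < 1}"
  morphisms prob_val Abs_open_prob
  by (rule exI[of _ "1/2"]) simp

datatype 'a cmd =
    Skip
  | Atom 'a
  | Seq "'a cmd" "'a cmd"
  | Choice open_prob "'a cmd" "'a cmd"
  | Par "'a cmd" "'a cmd"

datatype 'a label = Act 'a | Sk | Tau

datatype 'a residual = Done | Cont "'a cmd"

text \<open>
  The distributions \<open>\<Sum>i. p\<^sub>i \<cdot> (l, C\<^sub>i)\<close> are formal sums: finite multisets of weighted outcomes in
  which equal outcomes are not collected.  For \<open>a \<oplus>\<^sub>p a\<close> this keeps the two summands
  \<open>p \<cdot> (\<tau> a, \<checkmark>)\<close> and \<open>(1 - p) \<cdot> (\<tau> a, \<checkmark>)\<close> apart, which correspond to two different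
  maximal configurations; collecting them would give weight 1, the valuation of neither.
\<close>

type_synonym ('l, 'a) formal_sum = "(real \<times> 'l \<times> 'a residual) multiset"

inductive step :: "'a cmd \<Rightarrow> ('a label, 'a) formal_sum \<Rightarrow> bool" where
  step_skip: "step Skip {#(1, Sk, Done)#}"
| step_atom: "step (Atom a) {#(1, Act a, Done)#}"
| step_choice:
    "step (Choice p C1 C2) {#(prob_val p, Tau, Cont C1), (1 - prob_val p, Tau, Cont C2)#}"
| step_seq_done:
    "step C1 {#(1, l, Done)#} \<Longrightarrow> step (Seq C1 C2) {#(1, l, Cont C2)#}"
| step_seq_cont:
    "step C1 {#(1, l, Cont C1')#} \<Longrightarrow> step (Seq C1 C2) {#(1, l, Cont (Seq C1' C2))#}"
| step_seq_tau:
    "step C1 (\<Sum>i<(n::nat). {#(p i, Tau, Cont (C i))#}) \<Longrightarrow>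
     step (Seq C1 C2) (\<Sum>i<n. {#(p i, Tau, Cont (Seq (C i) C2))#})"
| step_par_left_done:
    "step C1 {#(1, l, Done)#} \<Longrightarrow> step (Par C1 C2) {#(1, l, Cont C2)#}"
| step_par_left_cont:
    "step C1 {#(1, l, Cont C1')#} \<Longrightarrow> step (Par C1 C2) {#(1, l, Cont (Par C1' C2))#}"
| step_par_left_tau:
    "step C1 (\<Sum>i<(n::nat). {#(p i, Tau, Cont (C i))#}) \<Longrightarrow>
     step (Par C1 C2) (\<Sum>i<n. {#(p i, Tau, Cont (Par (C i) C2))#})"
| step_par_right_done:
    "step C2 {#(1, l, Done)#} \<Longrightarrow> step (Par C1 C2) {#(1, l, Cont C1)#}"
| step_par_right_cont:
    "step C2 {#(1, l, Cont C2')#} \<Longrightarrow> step (Par C1 C2) {#(1, l, Cont (Par C1 C2'))#}"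
| step_par_right_tau:
    "step C2 (\<Sum>i<(n::nat). {#(p i, Tau, Cont (C i))#}) \<Longrightarrow>
     step (Par C1 C2) (\<Sum>i<n. {#(p i, Tau, Cont (Par C1 (C i)))#})"

text \<open>\<open>prefix_sum p l D\<close> is \<open>\<Sum>j. p p\<^sub>j \<cdot> (l : \<omega>\<^sub>j, C\<^sub>j)\<close> for \<open>D = \<Sum>j. p\<^sub>j \<cdot> (\<omega>\<^sub>j, C\<^sub>j)\<close>.\<close>

definition prefix_sum ::
  "real \<Rightarrow> 'a label \<Rightarrow> ('a label list, 'a) formal_sum \<Rightarrow> ('a label list, 'a) formal_sum" where
  "prefix_sum p l D = image_mset (\<lambda>(q, w, r). (p * q, l # w, r)) D"

text \<open>As \<open>\<checkmark>\<close> does not step, the second rule requires that all summands be commands.\<close>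

inductive multi_step :: "'a cmd \<Rightarrow> ('a label list, 'a) formal_sum \<Rightarrow> bool" where
  multi_one:
    "step C (\<Sum>i<(n::nat). {#(p i, l, r i)#}) \<Longrightarrow> multi_step C (\<Sum>i<n. {#(p i, [l], r i)#})"
| multi_more:
    "step C (\<Sum>i<(n::nat). {#(p i, l, Cont (C' i))#}) \<Longrightarrow> (\<And>i. i < n \<Longrightarrow> multi_step (C' i) (D i)) \<Longrightarrow>
     multi_step C (\<Sum>i<n. prefix_sum (p i) l (D i))"


section \<open>Labelled probabilistic event structures\<close>

text \<open>
  The record holds the raw data, the axioms are \<open>event_structure\<close> and \<open>prob_event_structure\<close>.
  Configurations and valuations of a command only refer to the data.
\<close>

record ('e, 'l) pes =
  events :: "'e set"
  causes :: "('e \<times> 'e) set"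
  conflict :: "('e \<times> 'e) set"
  lab :: "'e \<Rightarrow> 'l"
  val :: "'e set \<Rightarrow> real"

definition event_structure :: "('e, 'l) pes \<Rightarrow> bool" where
  "event_structure P \<longleftrightarrow>
     partial_order_on (events P) (causes P) \<and> causes P \<subseteq> events P \<times> events P \<and>
     (\<forall>e \<in> events P. finite {d. (d, e) \<in> causes P}) \<and>
     conflict P \<subseteq> events P \<times> events P \<and> irrefl (conflict P) \<and> sym (conflict P) \<and>
     (\<forall>d e f. (d, e) \<in> conflict P \<longrightarrow> (e, f) \<in> causes P \<longrightarrow> (d, f) \<in> conflict P)"

definition configs :: "('e, 'l) pes \<Rightarrow> 'e set set" where
  "configs P = {x. x \<subseteq> events P \<and>
     (\<forall>e \<in> x. \<forall>d. (d, e) \<in> causes P \<longrightarrow> d \<in> x) \<and>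
     (\<forall>d \<in> x. \<forall>e \<in> x. (d, e) \<notin> conflict P)}"

definition max_configs :: "('e, 'l) pes \<Rightarrow> 'e set set" where
  "max_configs P = {x \<in> configs P. \<forall>y \<in> configs P. x \<subseteq> y \<longrightarrow> y = x}"

text \<open>Drop condition; the valuation vanishes on sets that are not finite configurations.\<close>

definition prob_event_structure :: "('e, 'l) pes \<Rightarrow> bool" where
  "prob_event_structure P \<longleftrightarrow>
     event_structure P \<and> val P {} = 1 \<and>
     (\<forall>x. \<not> (x \<in> configs P \<and> finite x) \<longrightarrow> val P x = 0) \<and>
     (\<forall>y n. \<forall>x :: nat \<Rightarrow> _.
        y \<in> configs P \<longrightarrow> finite y \<longrightarrow>
        (\<forall>i \<in> {1..n}. x i \<in> configs P \<and> finite (x i) \<and> y \<subseteq> x i) \<longrightarrow>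
        val P y - (\<Sum>I \<in> Pow {1..n} - {{}}. (- 1) ^ (card I + 1) * val P (\<Union>i \<in> I. x i)) \<ge> 0)"

text \<open>
  A covering chain \<open>{} = x 0 \<subset> x 1 \<subset> \<dots> \<subset> x n\<close>, where \<open>e i\<close> is the event added in passing from
  \<open>x i\<close> to \<open>x (i + 1)\<close>.
\<close>

definition covering_chain ::
  "('e, 'l) pes \<Rightarrow> nat \<Rightarrow> (nat \<Rightarrow> 'e set) \<Rightarrow> (nat \<Rightarrow> 'e) \<Rightarrow> 'e set \<Rightarrow> bool" where
  "covering_chain P n x e x0 \<longleftrightarrow>
     x 0 = {} \<and> x n = x0 \<and> (\<forall>i\<le>n. x i \<in> configs P) \<and>
     (\<forall>i<n. e i \<notin> x i \<and> x (Suc i) = insert (e i) (x i))"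

definition chain_labels :: "('e, 'l) pes \<Rightarrow> nat \<Rightarrow> (nat \<Rightarrow> 'e) \<Rightarrow> 'l list" where
  "chain_labels P n e = map (\<lambda>i. lab P (e i)) [0..<n]"


section \<open>Interpretation of commands\<close>

text \<open>
  One event type for all commands: \<open>InL\<close> and \<open>InR\<close> are the injections of the disjoint unions,
  \<open>Init\<close> is the initial event of a choice, and \<open>After e x\<close> is the copy \<open>(e, x)\<close> of an event of the
  second component of a sequential composition, \<open>x\<close> being a maximal configuration of the first.
  Event structures of commands have finitely many events, so finite sets suffice for \<open>x\<close>.
\<close>

datatype event = Pt | Init | InL event | InR event | After event "event fset"

type_synonym 'a cmd_pes = "(event, 'a label) pes"

definition zero_off_configs :: "('e, 'l) pes \<Rightarrow> ('e, 'l) pes" where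
  "zero_off_configs P = P\<lparr>val := (\<lambda>x. if x \<in> configs P then val P x else 0)\<rparr>"

definition pes_single :: "'a label \<Rightarrow> 'a cmd_pes" where
  "pes_single l = zero_off_configs
     \<lparr>events = {Pt}, causes = {(Pt, Pt)}, conflict = {}, lab = (\<lambda>_. l), val = (\<lambda>_. 1)\<rparr>"

definition seq_causes :: "'a cmd_pes \<Rightarrow> 'a cmd_pes \<Rightarrow> (event \<times> event) set" where
  "seq_causes P Q =
     {(InL d, InL e) | d e. (d, e) \<in> causes P} \<union>
     {(InL d, After e x) | d e x. e \<in> events Q \<and> fset x \<in> max_configs P \<and> d \<in> fset x} \<union>
     {(After d x, After e x) | d e x. (d, e) \<in> causes Q \<and> fset x \<in> max_configs P}"

text \<open>
  The conflict of a sequential composition is the hereditary closure of the conflict of the first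
  component and of the conflicts inside each copy of the second.  It relates \<open>After d x\<close> and
  \<open>After e y\<close> whenever \<open>x \<noteq> y\<close>, because distinct maximal configurations contain conflicting events.
\<close>

definition seq_conflict :: "'a cmd_pes \<Rightarrow> 'a cmd_pes \<Rightarrow> (event \<times> event) set" where
  "seq_conflict P Q =
     (seq_causes P Q)\<inverse> O
     ({(InL d, InL e) | d e. (d, e) \<in> conflict P} \<union>
      {(After d x, After e x) | d e x. (d, e) \<in> conflict Q \<and> fset x \<in> max_configs P}) O
     seq_causes P Q"

text \<open>
  A configuration that is not contained in the first component has the form
  \<open>x\<^sub>1 \<union> x\<^sub>2 \<times> {x\<^sub>1}\<close> with \<open>x\<^sub>1\<close> maximal.
\<close>

definition pes_seq :: "'a cmd_pes \<Rightarrow> 'a cmd_pes \<Rightarrow> 'a cmd_pes" where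
  "pes_seq P Q = zero_off_configs
     \<lparr>events = InL ` events P \<union> {After e x | e x. e \<in> events Q \<and> fset x \<in> max_configs P},
      causes = seq_causes P Q,
      conflict = seq_conflict P Q,
      lab = (\<lambda>e. case e of InL d \<Rightarrow> lab P d | After d x \<Rightarrow> lab Q d | _ \<Rightarrow> undefined),
      val = (\<lambda>x. if x \<subseteq> range InL then val P (InL -` x)
                 else val P (InL -` x) * val Q {e. \<exists>y. After e y \<in> x})\<rparr>"

definition pes_choice :: "real \<Rightarrow> 'a cmd_pes \<Rightarrow> 'a cmd_pes \<Rightarrow> 'a cmd_pes" where
  "pes_choice p P Q = zero_off_configs
     \<lparr>events = {Init} \<union> InL ` events P \<union> InR ` events Q,
      causes =
        {Init} \<times> ({Init} \<union> InL ` events P \<union> InR ` events Q) \<union>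
        {(InL d, InL e) | d e. (d, e) \<in> causes P} \<union>
        {(InR d, InR e) | d e. (d, e) \<in> causes Q},
      conflict =
        {(InL d, InL e) | d e. (d, e) \<in> conflict P} \<union>
        {(InR d, InR e) | d e. (d, e) \<in> conflict Q} \<union>
        InL ` events P \<times> InR ` events Q \<union> InR ` events Q \<times> InL ` events P,
      lab = (\<lambda>e. case e of Init \<Rightarrow> Tau | InL d \<Rightarrow> lab P d | InR d \<Rightarrow> lab Q d | _ \<Rightarrow> undefined),
      val = (\<lambda>x. if x \<subseteq> {Init} then 1
                 else if x \<subseteq> {Init} \<union> range InL then p * val P (InL -` x)
                 else (1 - p) * val Q (InR -` x))\<rparr>"

definition pes_par :: "'a cmd_pes \<Rightarrow> 'a cmd_pes \<Rightarrow> 'a cmd_pes" where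
  "pes_par P Q = zero_off_configs
     \<lparr>events = InL ` events P \<union> InR ` events Q,
      causes =
        {(InL d, InL e) | d e. (d, e) \<in> causes P} \<union>
        {(InR d, InR e) | d e. (d, e) \<in> causes Q},
      conflict =
        {(InL d, InL e) | d e. (d, e) \<in> conflict P} \<union>
        {(InR d, InR e) | d e. (d, e) \<in> conflict Q},
      lab = (\<lambda>e. case e of InL d \<Rightarrow> lab P d | InR d \<Rightarrow> lab Q d | _ \<Rightarrow> undefined),
      val = (\<lambda>x. val P (InL -` x) * val Q (InR -` x))\<rparr>"

primrec denot :: "'a cmd \<Rightarrow> 'a cmd_pes" where
  "denot Skip = pes_single Sk"
| "denot (Atom a) = pes_single (Act a)"
| "denot (Seq C1 C2) = pes_seq (denot C1) (denot C2)"
| "denot (Choice p C1 C2) = pes_choice (prob_val p) (denot C1) (denot C2)"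
| "denot (Par C1 C2) = pes_par (denot C1) (denot C2)"

end

theory Submission
  imports Defs
begin

text \<open>
  A summand \<open>p \<cdot> (\<omega>, \<checkmark>)\<close> of a multi-step comes from a single run of the command that picks one
  summand at every step and multiplies the weights.  Runs decompose along the syntax: a run of
  \<open>C\<^sub>1; C\<^sub>2\<close> is a concatenation and a run of \<open>C\<^sub>1 \<parallel> C\<^sub>2\<close> a shuffle of runs of the components, with
  the product of their weights.  Maximal configurations with their linearisations and valuations
  decompose in the same way, so structural induction suffices and residual event structures are
  not needed.
\<close>

section \<open>Terminating runs extracted from multi-steps\<close>

inductive run :: "'a cmd \<Rightarrow> real \<Rightarrow> 'a label list \<Rightarrow> bool" where
  run_last: "step C D \<Longrightarrow> (p, l, Done) \<in># D \<Longrightarrow> run C p [l]"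
| run_more: "step C D \<Longrightarrow> (q, l, Cont C') \<in># D \<Longrightarrow> run C' p w \<Longrightarrow> run C (q * p) (l # w)"

lemma in_sum_mset_lessThan: "z \<in># (\<Sum>i<(n::nat). M i) \<longleftrightarrow> (\<exists>i<n. z \<in># M i)"
  by (induction n) (auto simp: lessThan_Suc less_Suc_eq)

text \<open>A summand of a multi-step stays attached to one index at every stage: it lies in a
  single \<open>prefix_sum (p' i) l (D i)\<close>, so it is the chosen outcome \<open>i\<close> of
  the first step followed by a summand of \<open>D i\<close>. As formal sums do not collect equal
  outcomes, its weight is the product along this one path.\<close>

lemma multi_step_Done_run:
  assumes "multi_step C D" "(p, w, Done) \<in># D"
  shows "run C p w"
  using assms
proof (induction arbitrary: p w rule: multi_step.induct)
  case (multi_one C p' l r n)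
  then show ?case
    by (auto simp: in_sum_mset_lessThan intro!: run_last)
next
  case (multi_more C p' l C' n D)
  then obtain i q w' where i: "i < n" "(q, w', Done) \<in># D i" "p = p' i * q" "w = l # w'"
    by (auto simp: in_sum_mset_lessThan prefix_sum_def)
  have "(p' i, l, Cont (C' i)) \<in># (\<Sum>i<n. {#(p' i, l, Cont (C' i))#})"
    using i by (auto simp: in_sum_mset_lessThan)
  then show ?case
    using multi_more i by (auto intro: run_more)
qed

text \<open>Nonempty words come from nonempty sets of events. The choice and sequential cases need
  this to land in the right branch of the valuation, and choice also needs it for
  maximality.\<close>

lemma run_not_Nil: "run C p w \<Longrightarrow> w \<noteq> []"
  by (induction rule: run.induct) auto

section \<open>Decomposition of runs along the syntax\<close>

inductive_cases step_SkipE: "step Skip D"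
inductive_cases step_AtomE: "step (Atom a) D"
inductive_cases step_ChoiceE: "step (Choice p C1 C2) D"
inductive_cases step_SeqE: "step (Seq C1 C2) D"
inductive_cases step_ParE: "step (Par C1 C2) D"

lemma run_Skip: "run Skip p w \<Longrightarrow> p = 1 \<and> w = [Sk]"
  by (erule run.cases) (auto elim!: step_SkipE)

lemma run_Atom: "run (Atom a) p w \<Longrightarrow> p = 1 \<and> w = [Act a]"
  by (erule run.cases) (auto elim!: step_AtomE)

lemma run_Choice:
  assumes "run (Choice q C1 C2) p w"
  shows "\<exists>p' w'. w = Tau # w' \<and>
    (run C1 p' w' \<and> p = prob_val q * p' \<or> run C2 p' w' \<and> p = (1 - prob_val q) * p')"
  using assms by cases (auto elim!: step_ChoiceE)

text \<open>The three rules for \<open>Seq\<close> all keep weight and label and merely rewrap the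
  residual of \<open>C1\<close>, so they merge into one description of a single outcome. The
  residual is always a \<open>Cont\<close>: a sequential composition never finishes in its first
  step.\<close>

lemma step_Seq_outcome:
  assumes "step (Seq C1 C2) D" "(p, l, r) \<in># D"
  shows "\<exists>D1 r1. step C1 D1 \<and> (p, l, r1) \<in># D1 \<and>
    r = Cont (case r1 of Done \<Rightarrow> C2 | Cont C1' \<Rightarrow> Seq C1' C2)"
  using assms
  by (elim step_SeqE)
     (force simp: in_sum_mset_lessThan split: residual.splits)+

lemma step_Par_outcome:
  assumes "step (Par C1 C2) D" "(p, l, r) \<in># D"
  shows "(\<exists>D1 r1. step C1 D1 \<and> (p, l, r1) \<in># D1 \<and>
      r = Cont (case r1 of Done \<Rightarrow> C2 | Cont C1' \<Rightarrow> Par C1' C2)) \<or>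
    (\<exists>D2 r2. step C2 D2 \<and> (p, l, r2) \<in># D2 \<and>
      r = Cont (case r2 of Done \<Rightarrow> C1 | Cont C2' \<Rightarrow> Par C1 C2'))"
  using assms
  by (elim step_ParE)
     (force simp: in_sum_mset_lessThan split: residual.splits)+

text \<open>Each step changes only the left component, hence the induction keeps \<open>C2\<close>
  fixed and generalises \<open>C1\<close>. When \<open>C1\<close> reaches \<open>Done\<close>, the
  rest of the run is already a run of \<open>C2\<close> and the word splits there; otherwise the
  first letter and weight are added to the run of \<open>C1\<close>.\<close>

lemma run_Seq:
  assumes "run (Seq C1 C2) p w"
  shows "\<exists>p1 w1 p2 w2. run C1 p1 w1 \<and> run C2 p2 w2 \<and> p = p1 * p2 \<and> w = w1 @ w2"
  using assms
proof (induction "Seq C1 C2" p w arbitrary: C1 rule: run.induct)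
  case (run_last D p l)
  then show ?case by (auto dest: step_Seq_outcome)
next
  case (run_more D q l C' p w)
  then obtain D1 r1 where 1: "step C1 D1" "(q, l, r1) \<in># D1"
    and C': "C' = (case r1 of Done \<Rightarrow> C2 | Cont C1' \<Rightarrow> Seq C1' C2)"
    by (auto dest: step_Seq_outcome)
  show ?case
  proof (cases r1)
    case Done
    then show ?thesis
      using 1 C' run_more.hyps(3) run.run_last[of C1 D1 q l]
      by (intro exI[of _ q] exI[of _ "[l]"] exI[of _ p] exI[of _ w]) auto
  next
    case (Cont C1')
    then obtain p1 w1 p2 w2
      where "run C1' p1 w1" "run C2 p2 w2" "p = p1 * p2" "w = w1 @ w2"
      using run_more.hyps(4) C' by auto
    then show ?thesis
      using 1 Cont run.run_more[of C1 D1 q l C1' p1 w1]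
      by (intro exI[of _ "q * p1"] exI[of _ "l # w1"] exI[of _ p2] exI[of _ w2]) auto
  qed
qed

text \<open>Either side may move, so both components are generalised. If the moving side reaches
  \<open>Done\<close>, its own run is the single letter \<open>l\<close>, and the remaining word
  \<open>w\<close> is entirely a run of the other side.\<close>

lemma run_Par:
  assumes "run (Par C1 C2) p w"
  shows "\<exists>p1 w1 p2 w2. run C1 p1 w1 \<and> run C2 p2 w2 \<and> p = p1 * p2 \<and> w \<in> shuffles w1 w2"
  using assms
proof (induction "Par C1 C2" p w arbitrary: C1 C2 rule: run.induct)
  case (run_last D p l)
  then show ?case by (auto dest: step_Par_outcome)
next
  case (run_more D q l C' p w)
  from step_Par_outcome[OF run_more.hyps(1,2)] consider
      D1 r1 where "step C1 D1" "(q, l, r1) \<in># D1"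
        "C' = (case r1 of Done \<Rightarrow> C2 | Cont C1' \<Rightarrow> Par C1' C2)"
    | D2 r2 where "step C2 D2" "(q, l, r2) \<in># D2"
        "C' = (case r2 of Done \<Rightarrow> C1 | Cont C2' \<Rightarrow> Par C1 C2')"
    by auto
  then show ?case
  proof cases
    case 1
    show ?thesis
    proof (cases r1)
      case Done
      then show ?thesis
        using 1 run_more.hyps(3) run.run_last[of C1 D1 q l]
        by (intro exI[of _ q] exI[of _ "[l]"] exI[of _ p] exI[of _ w])
           (auto intro: Cons_in_shuffles_leftI)
    next
      case (Cont C1')
      then obtain p1 w1 p2 w2
        where "run C1' p1 w1" "run C2 p2 w2" "p = p1 * p2" "w \<in> shuffles w1 w2"
        using run_more.hyps(4) 1 by auto
      then show ?thesis
        using 1 Cont run.run_more[of C1 D1 q l C1' p1 w1]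
        by (intro exI[of _ "q * p1"] exI[of _ "l # w1"] exI[of _ p2] exI[of _ w2])
           (auto intro: Cons_in_shuffles_leftI)
    qed
  next
    case 2
    show ?thesis
    proof (cases r2)
      case Done
      then show ?thesis
        using 2 run_more.hyps(3) run.run_last[of C2 D2 q l]
        by (intro exI[of _ p] exI[of _ w] exI[of _ q] exI[of _ "[l]"])
           (auto intro: Cons_in_shuffles_rightI)
    next
      case (Cont C2')
      then obtain p1 w1 p2 w2
        where "run C1 p1 w1" "run C2' p2 w2" "p = p1 * p2" "w \<in> shuffles w1 w2"
        using run_more.hyps(4) 2 by auto
      then show ?thesis
        using 2 Cont run.run_more[of C2 D2 q l C2' p2 w2]
        by (intro exI[of _ p1] exI[of _ w1] exI[of _ "q * p2"] exI[of _ "l # w2"])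
           (auto intro: Cons_in_shuffles_rightI)
    qed
  qed
qed

section \<open>Shuffles of event lists and their prefixes\<close>

text \<open>Equal labels may occur on both sides, so a shuffled word does not determine the origin
  of its letters. Following the derivation of the shuffle letter by letter fixes an origin for each,
  which lifts the interleaving from labels to tagged events.\<close>

lemma shuffles_mapD:
  assumes "w \<in> shuffles (map f xs) (map g ys)"
  shows "\<exists>zs \<in> shuffles (map Inl xs) (map Inr ys). w = map (case_sum f g) zs"
  using assms
proof (induction w arbitrary: xs ys)
  case Nil
  then show ?case by auto
next
  case (Cons a w)
  then consider x xs' where "xs = x # xs'" "a = f x" "w \<in> shuffles (map f xs') (map g ys)"
    | y ys' where "ys = y # ys'" "a = g y" "w \<in> shuffles (map f xs) (map g ys')"
    by (auto simp: Cons_in_shuffles_iff Cons_eq_map_conv neq_Nil_conv)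
  then show ?case
  proof cases
    case 1
    with Cons.IH obtain zs where "zs \<in> shuffles (map Inl xs') (map Inr ys)"
      "w = map (case_sum f g) zs" by blast
    with 1 show ?thesis
      by (intro bexI[of _ "Inl x # zs"]) (auto intro: Cons_in_shuffles_leftI)
  next
    case 2
    with Cons.IH obtain zs where "zs \<in> shuffles (map Inl xs) (map Inr ys')"
      "w = map (case_sum f g) zs" by blast
    with 2 show ?thesis
      by (intro bexI[of _ "Inr y # zs"]) (auto intro: Cons_in_shuffles_rightI)
  qed
qed

text \<open>Used to cut an interleaved linearisation: any initial segment only involves initial
  segments of the two sides, and these are known to be configurations.\<close>

lemma shuffles_prefixD:
  assumes "us @ vs \<in> shuffles xs ys"
  shows "\<exists>xs1 xs2 ys1 ys2. xs = xs1 @ xs2 \<and> ys = ys1 @ ys2 \<and> us \<in> shuffles xs1 ys1"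
  using assms
proof (induction us arbitrary: xs ys)
  case Nil
  then show ?case by force
next
  case (Cons a us)
  then consider xs' where "xs = a # xs'" "us @ vs \<in> shuffles xs' ys"
    | ys' where "ys = a # ys'" "us @ vs \<in> shuffles xs ys'"
    by (auto simp: Cons_in_shuffles_iff neq_Nil_conv)
  then show ?case
  proof cases
    case 1
    with Cons.IH[of xs' ys] show ?thesis
      by (metis Cons_in_shuffles_leftI append_Cons)
  next
    case 2
    with Cons.IH[of xs ys'] show ?thesis
      by (metis Cons_in_shuffles_rightI append_Cons)
  qed
qed

section \<open>Configurations and maximal configurations\<close>

lemma configs_zero_off [simp]: "configs (zero_off_configs P) = configs P"
  by (simp add: configs_def zero_off_configs_def)

lemma max_configs_zero_off [simp]: "max_configs (zero_off_configs P) = max_configs P"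
  by (simp add: max_configs_def)

lemma zero_off_sel [simp]:
  "events (zero_off_configs P) = events P" "causes (zero_off_configs P) = causes P"
  "conflict (zero_off_configs P) = conflict P" "lab (zero_off_configs P) = lab P"
  "val (zero_off_configs P) = (\<lambda>x. if x \<in> configs P then val P x else 0)"
  by (simp_all add: zero_off_configs_def)

lemma empty_in_configs [simp]: "{} \<in> configs P"
  by (simp add: configs_def)

lemma max_configs_configs: "x \<in> max_configs P \<Longrightarrow> x \<in> configs P"
  by (simp add: max_configs_def)

lemma max_configs_eq: "x \<in> max_configs P \<Longrightarrow> y \<in> configs P \<Longrightarrow> x \<subseteq> y \<Longrightarrow> y = x"
  by (simp add: max_configs_def)

lemma max_configsI:
  "x \<in> configs P \<Longrightarrow> (\<And>y. y \<in> configs P \<Longrightarrow> x \<subseteq> y \<Longrightarrow> y = x) \<Longrightarrow> x \<in> max_configs P"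
  by (simp add: max_configs_def)

lemma configs_events: "x \<in> configs P \<Longrightarrow> x \<subseteq> events P"
  by (simp add: configs_def)

lemma configs_causes: "x \<in> configs P \<Longrightarrow> (d, e) \<in> causes P \<Longrightarrow> e \<in> x \<Longrightarrow> d \<in> x"
  by (auto simp: configs_def)

lemma configs_conflict: "x \<in> configs P \<Longrightarrow> d \<in> x \<Longrightarrow> e \<in> x \<Longrightarrow> (d, e) \<notin> conflict P"
  by (simp add: configs_def)

lemma configsI:
  assumes "x \<subseteq> events P" "\<And>d e. (d, e) \<in> causes P \<Longrightarrow> e \<in> x \<Longrightarrow> d \<in> x"
    "\<And>d e. d \<in> x \<Longrightarrow> e \<in> x \<Longrightarrow> (d, e) \<notin> conflict P"
  shows "x \<in> configs P"
  using assms by (auto simp: configs_def)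

section \<open>Linearisations and realised words\<close>

text \<open>Serves the sequential case: \<open>seq_conflict\<close> is obtained by composing with
  \<open>seq_causes\<close> on both sides, and a component's own conflict is recovered from it by
  taking both causal steps to be reflexive.\<close>

definition refl_causes :: "('e, 'l) pes \<Rightarrow> bool" where
  "refl_causes P \<longleftrightarrow> (\<forall>e \<in> events P. (e, e) \<in> causes P)"

lemma refl_causes_denot: "refl_causes (denot C)"
  by (induction C)
     (auto simp: refl_causes_def pes_single_def pes_seq_def pes_choice_def pes_par_def
       seq_causes_def)

text \<open>List form of a covering chain: the prefixes are its configurations, and distinctness
  makes every added event new. Lists are convenient because runs compose by concatenation and
  shuffling.\<close>

definition linearises :: "('e, 'l) pes \<Rightarrow> 'e list \<Rightarrow> bool" where
  "linearises P es \<longleftrightarrow> distinct es \<and> (\<forall>us vs. es = us @ vs \<longrightarrow> set us \<in> configs P)"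

text \<open>The invariant of the structural induction, stated for an arbitrary structure so that
  each operation on event structures can be treated separately.\<close>

definition realises :: "('e, 'l) pes \<Rightarrow> real \<Rightarrow> 'l list \<Rightarrow> bool" where
  "realises P p w \<longleftrightarrow> (\<exists>es. linearises P es \<and> set es \<in> max_configs P \<and>
     map (lab P) es = w \<and> val P (set es) = p)"

lemma realisesI:
  "linearises P es \<Longrightarrow> set es \<in> max_configs P \<Longrightarrow> map (lab P) es = w \<Longrightarrow> val P (set es) = p \<Longrightarrow>
     realises P p w"
  unfolding realises_def by blast

lemma realises_single: "realises (pes_single l) 1 [l]"
proof -
  have configs: "configs (pes_single l) = {{}, {Pt}}"
    by (auto simp: configs_def pes_single_def subset_singleton_iff)
  then have max: "{Pt} \<in> max_configs (pes_single l)"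
    by (simp add: max_configs_def)
  have "set us \<in> configs (pes_single l)" if "[Pt] = us @ vs" for us vs
    using that configs by (cases us) auto
  then have "linearises (pes_single l) [Pt]"
    by (simp add: linearises_def)
  moreover have "val (pes_single l) {Pt} = 1" "lab (pes_single l) Pt = l"
    using max_configs_configs[OF max] by (simp_all add: pes_single_def)
  ultimately show ?thesis
    unfolding realises_def using max by (intro exI[of _ "[Pt]"]) simp
qed

subsection \<open>Choice\<close>

lemma choice_sel:
  "events (pes_choice p P Q) = {Init} \<union> InL ` events P \<union> InR ` events Q"
  "causes (pes_choice p P Q) =
     {Init} \<times> ({Init} \<union> InL ` events P \<union> InR ` events Q) \<union>
     {(InL d, InL e) | d e. (d, e) \<in> causes P} \<union>
     {(InR d, InR e) | d e. (d, e) \<in> causes Q}"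
  "conflict (pes_choice p P Q) =
     {(InL d, InL e) | d e. (d, e) \<in> conflict P} \<union>
     {(InR d, InR e) | d e. (d, e) \<in> conflict Q} \<union>
     InL ` events P \<times> InR ` events Q \<union> InR ` events Q \<times> InL ` events P"
  "lab (pes_choice p P Q) Init = Tau"
  "lab (pes_choice p P Q) (InL d) = lab P d"
  "lab (pes_choice p P Q) (InR d) = lab Q d"
  by (simp_all add: pes_choice_def)

lemma choice_order_iff [simp]:
  "(InL d, InL e) \<in> causes (pes_choice p P Q) \<longleftrightarrow> (d, e) \<in> causes P"
  "(InR d, InR e) \<in> causes (pes_choice p P Q) \<longleftrightarrow> (d, e) \<in> causes Q"
  "(InL d, InL e) \<in> conflict (pes_choice p P Q) \<longleftrightarrow> (d, e) \<in> conflict P"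
  "(InR d, InR e) \<in> conflict (pes_choice p P Q) \<longleftrightarrow> (d, e) \<in> conflict Q"
  by (auto simp: choice_sel)

lemma choice_val:
  "x \<in> configs (pes_choice p P Q) \<Longrightarrow> val (pes_choice p P Q) x =
     (if x \<subseteq> {Init} then 1
      else if x \<subseteq> {Init} \<union> range InL then p * val P (InL -` x)
      else (1 - p) * val Q (InR -` x))"
  by (simp add: pes_choice_def)

lemma choice_configI_left:
  "x \<in> configs P \<Longrightarrow> insert Init (InL ` x) \<in> configs (pes_choice p P Q)"
  by (simp add: configs_def choice_sel) blast

lemma choice_configI_right:
  "x \<in> configs Q \<Longrightarrow> insert Init (InR ` x) \<in> configs (pes_choice p P Q)"
  by (simp add: configs_def choice_sel) blast

lemma choice_config_left:
  assumes "y \<in> configs (pes_choice p P Q)"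
  shows "InL -` y \<in> configs P"
proof (rule configsI)
  show "InL -` y \<subseteq> events P"
    using configs_events[OF assms] by (auto simp: choice_sel)
  show "d \<in> InL -` y" if "(d, e) \<in> causes P" "e \<in> InL -` y" for d e
    using configs_causes[OF assms, of "InL d" "InL e"] that by simp
  show "(d, e) \<notin> conflict P" if "d \<in> InL -` y" "e \<in> InL -` y" for d e
    using configs_conflict[OF assms, of "InL d" "InL e"] that by simp
qed

lemma choice_config_right:
  assumes "y \<in> configs (pes_choice p P Q)"
  shows "InR -` y \<in> configs Q"
proof (rule configsI)
  show "InR -` y \<subseteq> events Q"
    using configs_events[OF assms] by (auto simp: choice_sel)
  show "d \<in> InR -` y" if "(d, e) \<in> causes Q" "e \<in> InR -` y" for d e
    using configs_causes[OF assms, of "InR d" "InR e"] that by simp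
  show "(d, e) \<notin> conflict Q" if "d \<in> InR -` y" "e \<in> InR -` y" for d e
    using configs_conflict[OF assms, of "InR d" "InR e"] that by simp
qed

text \<open>An event of \<open>x\<close> conflicts with every event of the right side, so a larger
  configuration stays on the left, where \<open>x\<close> is maximal. With \<open>x\<close> empty
  this fails as soon as the right side has a nonempty configuration.\<close>

lemma choice_max_configI_left:
  assumes x: "x \<in> max_configs P" and ne: "x \<noteq> {}"
  shows "insert Init (InL ` x) \<in> max_configs (pes_choice p P Q)"
proof -
  have "y = insert Init (InL ` x)"
    if y: "y \<in> configs (pes_choice p P Q)" and sub: "insert Init (InL ` x) \<subseteq> y" for y
  proof -
    have eq: "InL -` y = x"
      using max_configs_eq[OF x choice_config_left[OF y]] sub by auto
    obtain d where d: "d \<in> x" using ne by blast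
    then have "InL d \<in> y" "d \<in> events P"
      using sub configs_events[OF max_configs_configs[OF x]] by auto
    then have "InR e \<notin> y" if "e \<in> events Q" for e
      using configs_conflict[OF y, of "InL d" "InR e"] that by (auto simp: choice_sel)
    then have "y \<subseteq> {Init} \<union> range InL"
      using configs_events[OF y] by (auto simp: choice_sel)
    then show ?thesis using eq sub by auto
  qed
  then show ?thesis
    by (rule max_configsI[OF choice_configI_left[OF max_configs_configs[OF x]]])
qed

lemma choice_max_configI_right:
  assumes x: "x \<in> max_configs Q" and ne: "x \<noteq> {}"
  shows "insert Init (InR ` x) \<in> max_configs (pes_choice p P Q)"
proof -
  have "y = insert Init (InR ` x)"
    if y: "y \<in> configs (pes_choice p P Q)" and sub: "insert Init (InR ` x) \<subseteq> y" for y
  proof -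
    have eq: "InR -` y = x"
      using max_configs_eq[OF x choice_config_right[OF y]] sub by auto
    obtain d where d: "d \<in> x" using ne by blast
    then have "InR d \<in> y" "d \<in> events Q"
      using sub configs_events[OF max_configs_configs[OF x]] by auto
    then have "InL e \<notin> y" if "e \<in> events P" for e
      using configs_conflict[OF y, of "InR d" "InL e"] that by (auto simp: choice_sel)
    then have "y \<subseteq> {Init} \<union> range InR"
      using configs_events[OF y] by (auto simp: choice_sel)
    then show ?thesis using eq sub by auto
  qed
  then show ?thesis
    by (rule max_configsI[OF choice_configI_right[OF max_configs_configs[OF x]]])
qed

lemma realises_choice_left:
  assumes "realises P q w" "w \<noteq> []"
  shows "realises (pes_choice p P Q) (p * q) (Tau # w)"
proof -
  obtain es where es: "linearises P es" "set es \<in> max_configs P"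
    "map (lab P) es = w" "val P (set es) = q"
    using assms by (auto simp: realises_def)
  have ne: "set es \<noteq> {}" using es assms by auto
  have max: "set (Init # map InL es) \<in> max_configs (pes_choice p P Q)"
    using choice_max_configI_left[OF es(2) ne] by simp
  \<comment> \<open>A prefix is either empty or \<open>Init\<close> followed by the image of a
    prefix of \<open>es\<close>.\<close>
  have lin: "linearises (pes_choice p P Q) (Init # map InL es)"
    using es(1) by (auto simp: linearises_def distinct_map inj_on_def Cons_eq_append_conv
      map_eq_append_conv intro!: choice_configI_left)
  have vim: "InL -` insert Init (InL ` set es) = set es" by auto
  \<comment> \<open>Excludes the branch of the valuation in which \<open>{}\<close> and
    \<open>{Init}\<close> receive the constant value 1.\<close>
  have "\<not> insert Init (InL ` set es) \<subseteq> {Init}"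
    using ne by (cases es) auto
  with vim have val: "val (pes_choice p P Q) (set (Init # map InL es)) = p * q"
    using max_configs_configs[OF max] es(4) ne
    by (auto simp: choice_val)
  have lab: "map (lab (pes_choice p P Q)) (Init # map InL es) = Tau # w"
    using es(3) by (auto simp: choice_sel)
  show ?thesis
    by (rule realisesI[OF lin max lab val])
qed

lemma realises_choice_right:
  assumes "realises Q q w" "w \<noteq> []"
  shows "realises (pes_choice p P Q) ((1 - p) * q) (Tau # w)"
proof -
  obtain es where es: "linearises Q es" "set es \<in> max_configs Q"
    "map (lab Q) es = w" "val Q (set es) = q"
    using assms by (auto simp: realises_def)
  have ne: "set es \<noteq> {}" using es assms by auto
  have max: "set (Init # map InR es) \<in> max_configs (pes_choice p P Q)"
    using choice_max_configI_right[OF es(2) ne] by simp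
  have lin: "linearises (pes_choice p P Q) (Init # map InR es)"
    using es(1) by (auto simp: linearises_def distinct_map inj_on_def Cons_eq_append_conv
      map_eq_append_conv intro!: choice_configI_right)
  have vim: "InR -` insert Init (InR ` set es) = set es" by auto
  \<comment> \<open>An event on the right excludes both earlier branches, leaving the one with
    factor \<open>1 - p\<close>.\<close>
  have "\<not> insert Init (InR ` set es) \<subseteq> {Init} \<union> range InL"
    using ne by (cases es) auto
  with vim have val: "val (pes_choice p P Q) (set (Init # map InR es)) = (1 - p) * q"
    using max_configs_configs[OF max] es(4) ne
    by (auto simp: choice_val)
  have lab: "map (lab (pes_choice p P Q)) (Init # map InR es) = Tau # w"
    using es(3) by (auto simp: choice_sel)
  show ?thesis
    by (rule realisesI[OF lin max lab val])
qed

subsection \<open>Parallel composition\<close>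

lemma par_sel:
  "events (pes_par P Q) = InL ` events P \<union> InR ` events Q"
  "causes (pes_par P Q) =
     {(InL d, InL e) | d e. (d, e) \<in> causes P} \<union>
     {(InR d, InR e) | d e. (d, e) \<in> causes Q}"
  "conflict (pes_par P Q) =
     {(InL d, InL e) | d e. (d, e) \<in> conflict P} \<union>
     {(InR d, InR e) | d e. (d, e) \<in> conflict Q}"
  "lab (pes_par P Q) (InL d) = lab P d"
  "lab (pes_par P Q) (InR d) = lab Q d"
  by (simp_all add: pes_par_def)

lemma par_val:
  "x \<in> configs (pes_par P Q) \<Longrightarrow>
     val (pes_par P Q) x = val P (InL -` x) * val Q (InR -` x)"
  by (simp add: pes_par_def)

lemma par_order_iff:
  "(a, InL e) \<in> causes (pes_par P Q) \<longleftrightarrow> (\<exists>d. a = InL d \<and> (d, e) \<in> causes P)"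
  "(a, InR e) \<in> causes (pes_par P Q) \<longleftrightarrow> (\<exists>d. a = InR d \<and> (d, e) \<in> causes Q)"
  "(a, InL e) \<in> conflict (pes_par P Q) \<longleftrightarrow> (\<exists>d. a = InL d \<and> (d, e) \<in> conflict P)"
  "(a, InR e) \<in> conflict (pes_par P Q) \<longleftrightarrow> (\<exists>d. a = InR d \<and> (d, e) \<in> conflict Q)"
  by (auto simp: par_sel)

lemma par_configI:
  assumes x1: "x1 \<in> configs P" and x2: "x2 \<in> configs Q"
  shows "InL ` x1 \<union> InR ` x2 \<in> configs (pes_par P Q)" (is "?x \<in> _")
proof (rule configsI)
  show "?x \<subseteq> events (pes_par P Q)"
    using configs_events[OF x1] configs_events[OF x2] by (auto simp: par_sel)
  show "d \<in> ?x" if "(d, e) \<in> causes (pes_par P Q)" "e \<in> ?x" for d e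
    using that configs_causes[OF x1] configs_causes[OF x2] by (auto simp: par_order_iff)
  show "(d, e) \<notin> conflict (pes_par P Q)" if "d \<in> ?x" "e \<in> ?x" for d e
    using that configs_conflict[OF x1] configs_conflict[OF x2] by (auto simp: par_order_iff)
qed

lemma par_config_left:
  assumes "y \<in> configs (pes_par P Q)"
  shows "InL -` y \<in> configs P"
proof (rule configsI)
  show "InL -` y \<subseteq> events P"
    using configs_events[OF assms] by (auto simp: par_sel)
  show "d \<in> InL -` y" if "(d, e) \<in> causes P" "e \<in> InL -` y" for d e
    using configs_causes[OF assms, of "InL d" "InL e"] that by (simp add: par_order_iff)
  show "(d, e) \<notin> conflict P" if "d \<in> InL -` y" "e \<in> InL -` y" for d e
    using configs_conflict[OF assms, of "InL d" "InL e"] that by (simp add: par_order_iff)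
qed

lemma par_config_right:
  assumes "y \<in> configs (pes_par P Q)"
  shows "InR -` y \<in> configs Q"
proof (rule configsI)
  show "InR -` y \<subseteq> events Q"
    using configs_events[OF assms] by (auto simp: par_sel)
  show "d \<in> InR -` y" if "(d, e) \<in> causes Q" "e \<in> InR -` y" for d e
    using configs_causes[OF assms, of "InR d" "InR e"] that by (simp add: par_order_iff)
  show "(d, e) \<notin> conflict Q" if "d \<in> InR -` y" "e \<in> InR -` y" for d e
    using configs_conflict[OF assms, of "InR d" "InR e"] that by (simp add: par_order_iff)
qed

text \<open>Both projections of a larger configuration are configurations of the components that
  contain \<open>x1\<close> and \<open>x2\<close>, so maximality fixes each of them; every event
  carries one of the two tags.\<close>

lemma par_max_configI:
  assumes x1: "x1 \<in> max_configs P" and x2: "x2 \<in> max_configs Q"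
  shows "InL ` x1 \<union> InR ` x2 \<in> max_configs (pes_par P Q)"
proof -
  have "y = InL ` x1 \<union> InR ` x2"
    if y: "y \<in> configs (pes_par P Q)" and sub: "InL ` x1 \<union> InR ` x2 \<subseteq> y" for y
  proof -
    have "x1 \<subseteq> InL -` y" "x2 \<subseteq> InR -` y" using sub by auto
    then have "InL -` y = x1" "InR -` y = x2"
      using max_configs_eq[OF x1 par_config_left[OF y]]
        max_configs_eq[OF x2 par_config_right[OF y]] by simp_all
    then show ?thesis
      using configs_events[OF y] by (auto simp: par_sel)
  qed
  then show ?thesis
    by (rule max_configsI[OF par_configI[OF max_configs_configs[OF x1] max_configs_configs[OF x2]]])
qed

lemma realises_par:
  assumes "realises P p u" "realises Q q v" "w \<in> shuffles u v"
  shows "realises (pes_par P Q) (p * q) w"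
proof -
  obtain ds where ds: "linearises P ds" "set ds \<in> max_configs P"
    "map (lab P) ds = u" "val P (set ds) = p"
    using assms by (auto simp: realises_def)
  obtain es where es: "linearises Q es" "set es \<in> max_configs Q"
    "map (lab Q) es = v" "val Q (set es) = q"
    using assms by (auto simp: realises_def)
  obtain zs where zs: "zs \<in> shuffles (map Inl ds) (map Inr es)"
    "w = map (case_sum (lab P) (lab Q)) zs"
    using assms(3) shuffles_mapD ds(3) es(3) by blast
  \<comment> \<open>\<open>zs\<close> interleaves the events themselves, tagged in the sum type;
    \<open>fs\<close> turns these tags into the injections of \<open>event\<close>.\<close>
  define fs where "fs = map (case_sum InL InR) zs"
  have set_zs: "set zs = Inl ` set ds \<union> Inr ` set es"
    using set_shuffles[OF zs(1)] by simp
  then have set_fs: "set fs = InL ` set ds \<union> InR ` set es"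
    by (simp add: fs_def image_Un image_image)
  have max: "set fs \<in> max_configs (pes_par P Q)"
    using par_max_configI[OF ds(2) es(2)] set_fs by simp
  have "distinct zs"
    using distinct_disjoint_shuffles[OF _ _ _ zs(1)] ds(1) es(1)
    by (auto simp: linearises_def distinct_map)
  then have "distinct fs"
    by (auto simp: fs_def distinct_map inj_on_def split: sum.splits)
  moreover have "set us \<in> configs (pes_par P Q)" if "fs = us @ vs" for us vs
  proof -
    obtain us' vs' where us': "zs = us' @ vs'" "us = map (case_sum InL InR) us'"
      using \<open>fs = us @ vs\<close> unfolding fs_def map_eq_append_conv by blast
    \<comment> \<open>The prefix splits into a prefix of each linearisation, so its set is a union
      of one configuration from each side.\<close>
    obtain ds1 ds2 es1 es2 where 1: "map Inl ds = ds1 @ ds2" "map Inr es = es1 @ es2"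
      "us' \<in> shuffles ds1 es1"
      using shuffles_prefixD[OF zs(1)[unfolded us'(1)]] by blast
    obtain ds' es' where 2: "ds1 = map Inl ds'" "es1 = map Inr es'"
        "set ds' \<in> configs P" "set es' \<in> configs Q"
      using ds(1) es(1) 1(1,2) by (auto simp: linearises_def map_eq_append_conv)
    have "set us' = Inl ` set ds' \<union> Inr ` set es'"
      using set_shuffles[OF 1(3)] 2 by simp
    then have "set us = InL ` set ds' \<union> InR ` set es'"
      using us'(2) by (simp add: image_Un image_image)
    then show ?thesis using par_configI 2 by metis
  qed
  ultimately have lin: "linearises (pes_par P Q) fs"
    by (auto simp: linearises_def)
  have lab: "map (lab (pes_par P Q)) fs = w"
    by (auto simp: fs_def zs(2) par_sel split: sum.splits)
  have "InL -` set fs = set ds" "InR -` set fs = set es"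
    using set_fs by auto
  then have val: "val (pes_par P Q) (set fs) = p * q"
    using max_configs_configs[OF max] ds(4) es(4) by (auto simp: par_val)
  show ?thesis
    by (rule realisesI[OF lin max lab val])
qed

subsection \<open>Sequential composition\<close>

lemma seq_sel:
  "events (pes_seq P Q) =
     InL ` events P \<union> {After e x | e x. e \<in> events Q \<and> fset x \<in> max_configs P}"
  "causes (pes_seq P Q) = seq_causes P Q"
  "conflict (pes_seq P Q) = seq_conflict P Q"
  "lab (pes_seq P Q) (InL d) = lab P d"
  "lab (pes_seq P Q) (After d x) = lab Q d"
  by (simp_all add: pes_seq_def)

lemma seq_val:
  "x \<in> configs (pes_seq P Q) \<Longrightarrow> val (pes_seq P Q) x =
     (if x \<subseteq> range InL then val P (InL -` x)
      else val P (InL -` x) * val Q {e. \<exists>y. After e y \<in> x})"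
  by (simp add: pes_seq_def)

lemma seq_causes_InL_iff [simp]:
  "(a, InL e) \<in> seq_causes P Q \<longleftrightarrow> (\<exists>d. a = InL d \<and> (d, e) \<in> causes P)"
  by (auto simp: seq_causes_def)

lemma seq_causes_After_iff [simp]:
  "(a, After e x) \<in> seq_causes P Q \<longleftrightarrow> fset x \<in> max_configs P \<and>
     ((\<exists>d. a = InL d \<and> e \<in> events Q \<and> d \<in> fset x) \<or> (\<exists>d. a = After d x \<and> (d, e) \<in> causes Q))"
  by (auto simp: seq_causes_def)

text \<open>Every conflict is inherited from a generating one below it, either in the first
  component or inside a single copy \<open>z\<close> of the second. A down-closed set containing
  \<open>a\<close> and \<open>b\<close> also contains the generating pair, which is how
  conflict-freeness is checked below.\<close>

lemma seq_conflictE: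
  assumes "(a, b) \<in> seq_conflict P Q"
  obtains d e where "(InL d, a) \<in> seq_causes P Q" "(InL e, b) \<in> seq_causes P Q"
      "(d, e) \<in> conflict P"
    | d e z where "(After d z, a) \<in> seq_causes P Q" "(After e z, b) \<in> seq_causes P Q"
      "(d, e) \<in> conflict Q"
  using assms unfolding seq_conflict_def by blast

lemma seq_configI_first:
  assumes "x \<in> configs P"
  shows "InL ` x \<in> configs (pes_seq P Q)"
proof (rule configsI)
  show "InL ` x \<subseteq> events (pes_seq P Q)"
    using configs_events[OF assms] by (auto simp: seq_sel)
  show causes: "d \<in> InL ` x" if "(d, e) \<in> causes (pes_seq P Q)" "e \<in> InL ` x" for d e
    using that configs_causes[OF assms] by (auto simp: seq_sel)
  show "(a, b) \<notin> conflict (pes_seq P Q)" if "a \<in> InL ` x" "b \<in> InL ` x" for a b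
  proof
    assume "(a, b) \<in> conflict (pes_seq P Q)"
    then have "(a, b) \<in> seq_conflict P Q" by (simp add: seq_sel)
    then show False
    proof (cases rule: seq_conflictE)
      case (1 d e)
      then have "InL d \<in> InL ` x" "InL e \<in> InL ` x"
        using causes that by (auto simp: seq_sel)
      then show False using 1(3) configs_conflict[OF assms] by blast
    next
      case (2 d e z)
      then have "After d z \<in> InL ` x"
        using causes that by (auto simp: seq_sel)
      then show False by auto
    qed
  qed
qed

text \<open>Below a copied event \<open>After e z\<close> lie only events of \<open>fset z\<close>,
  all present, and copies with the same index. Hence the set is down-closed, and any conflict in it
  would descend to one within \<open>fset z\<close> or within \<open>x\<close>.\<close>

lemma seq_configI:
  assumes z: "fset z \<in> max_configs P" and x: "x \<in> configs Q"
  shows "InL ` fset z \<union> (\<lambda>e. After e z) ` x \<in> configs (pes_seq P Q)" (is "?x \<in> _")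
proof (rule configsI)
  note z' = max_configs_configs[OF z]
  show "?x \<subseteq> events (pes_seq P Q)"
    using configs_events[OF x] configs_events[OF z'] z by (auto simp: seq_sel)
  show causes: "d \<in> ?x" if "(d, e) \<in> causes (pes_seq P Q)" "e \<in> ?x" for d e
    using that configs_causes[OF x] configs_causes[OF z'] by (auto simp: seq_sel)
  show "(a, b) \<notin> conflict (pes_seq P Q)" if "a \<in> ?x" "b \<in> ?x" for a b
  proof
    assume "(a, b) \<in> conflict (pes_seq P Q)"
    then have "(a, b) \<in> seq_conflict P Q" by (simp add: seq_sel)
    then show False
    proof (cases rule: seq_conflictE)
      case (1 d e)
      then have "InL d \<in> ?x" "InL e \<in> ?x"
        using causes[of "InL d" a] causes[of "InL e" b] that by (simp_all add: seq_sel)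
      then have "d \<in> fset z" "e \<in> fset z" by auto
      then show False using 1(3) configs_conflict[OF z'] by blast
    next
      case (2 d e y)
      then have "After d y \<in> ?x" "After e y \<in> ?x"
        using causes[of "After d y" a] causes[of "After e y" b] that by (simp_all add: seq_sel)
      then have "d \<in> x" "e \<in> x" by auto
      then show False using 2(3) configs_conflict[OF x] by blast
    qed
  qed
qed

lemma seq_conflict_InL:
  "(d, e) \<in> conflict P \<Longrightarrow> (d, d) \<in> causes P \<Longrightarrow> (e, e) \<in> causes P \<Longrightarrow>
     (InL d, InL e) \<in> seq_conflict P Q"
  unfolding seq_conflict_def
  by (rule relcompI[where b = "InL d"]; (rule relcompI[where b = "InL e"])?) auto

lemma seq_conflict_After:
  "(d, e) \<in> conflict Q \<Longrightarrow> (d, d) \<in> causes Q \<Longrightarrow> (e, e) \<in> causes Q \<Longrightarrow>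
     fset z \<in> max_configs P \<Longrightarrow> (After d z, After e z) \<in> seq_conflict P Q"
  unfolding seq_conflict_def
  by (rule relcompI[where b = "After d z"]; (rule relcompI[where b = "After e z"])?) auto

lemma seq_config_first:
  assumes "refl_causes P" and y: "y \<in> configs (pes_seq P Q)"
  shows "InL -` y \<in> configs P"
proof (rule configsI)
  show events: "InL -` y \<subseteq> events P"
    using configs_events[OF y] by (auto simp: seq_sel)
  show "d \<in> InL -` y" if "(d, e) \<in> causes P" "e \<in> InL -` y" for d e
    using configs_causes[OF y, of "InL d" "InL e"] that by (simp add: seq_sel)
  show "(d, e) \<notin> conflict P" if "d \<in> InL -` y" "e \<in> InL -` y" for d e
  proof
    assume "(d, e) \<in> conflict P"
    moreover have "(d, d) \<in> causes P" "(e, e) \<in> causes P"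
      using that events assms(1) unfolding refl_causes_def by blast+
    ultimately show False
      using configs_conflict[OF y, of "InL d" "InL e"] that
      by (simp add: seq_sel seq_conflict_InL)
  qed
qed

lemma seq_config_second:
  assumes "refl_causes Q" and y: "y \<in> configs (pes_seq P Q)" and z: "fset z \<in> max_configs P"
  shows "{e. After e z \<in> y} \<in> configs Q"
proof (rule configsI)
  show events: "{e. After e z \<in> y} \<subseteq> events Q"
    using configs_events[OF y] by (auto simp: seq_sel)
  show "d \<in> {e. After e z \<in> y}" if "(d, e) \<in> causes Q" "e \<in> {e. After e z \<in> y}" for d e
    using configs_causes[OF y, of "After d z" "After e z"] that z by (simp add: seq_sel)
  show "(d, e) \<notin> conflict Q" if "d \<in> {e. After e z \<in> y}" "e \<in> {e. After e z \<in> y}" for d e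
  proof
    assume "(d, e) \<in> conflict Q"
    moreover have "(d, d) \<in> causes Q" "(e, e) \<in> causes Q"
      using that events assms(1) unfolding refl_causes_def by blast+
    ultimately show False
      using configs_conflict[OF y, of "After d z" "After e z"] that z
      by (simp add: seq_sel seq_conflict_After)
  qed
qed

text \<open>In a larger configuration \<open>y\<close> the first part must be \<open>fset z\<close>
  and the copy indexed by \<open>z\<close> must be \<open>x\<close>. What remains is to exclude
  events from copies with another index.\<close>

lemma seq_max_configI:
  assumes refl: "refl_causes P" "refl_causes Q"
    and z: "fset z \<in> max_configs P" and x: "x \<in> max_configs Q"
  shows "InL ` fset z \<union> (\<lambda>e. After e z) ` x \<in> max_configs (pes_seq P Q)" (is "?x \<in> _")
proof -
  have "y = ?x" if y: "y \<in> configs (pes_seq P Q)" and sub: "?x \<subseteq> y" for y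
  proof -
    have 1: "InL -` y = fset z"
      using max_configs_eq[OF z seq_config_first[OF refl(1) y]] sub by auto
    have 2: "{e. After e z \<in> y} = x"
      using max_configs_eq[OF x seq_config_second[OF refl(2) y z]] sub by auto
    \<comment> \<open>An event of the copy \<open>z'\<close> has all of \<open>fset z'\<close> below
      it, so \<open>fset z'\<close> is contained in \<open>fset z\<close>; maximality of
      \<open>fset z'\<close> then forces equality.\<close>
    have z_eq: "z' = z" if "After e z' \<in> y" for e z'
    proof -
      have z': "fset z' \<in> max_configs P" and "e \<in> events Q"
        using configs_events[OF y] that by (auto simp: seq_sel)
      then have "InL d \<in> y" if "d \<in> fset z'" for d
        using configs_causes[OF y, of "InL d" "After e z'"] \<open>After e z' \<in> y\<close> that
        by (simp add: seq_sel)
      then have "fset z' \<subseteq> fset z" using 1 by auto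
      then show ?thesis
        using max_configs_eq[OF z' max_configs_configs[OF z]] by (simp add: fset_inject)
    qed
    have "a \<in> ?x" if "a \<in> y" for a
    proof -
      consider d where "a = InL d" | e z' where "a = After e z'"
        using configs_events[OF y] \<open>a \<in> y\<close> by (auto simp: seq_sel)
      then show ?thesis
      proof cases
        case (1 d)
        then show ?thesis using \<open>InL -` y = fset z\<close> \<open>a \<in> y\<close> by auto
      next
        case (2 e z')
        then have "z' = z" "e \<in> x" using z_eq 2 \<open>{e. After e z \<in> y} = x\<close> \<open>a \<in> y\<close> by auto
        then show ?thesis using 2 by simp
      qed
    qed
    then show ?thesis using sub by blast
  qed
  then show ?thesis
    by (rule max_configsI[OF seq_configI[OF z max_configs_configs[OF x]]])
qed

lemma realises_seq:
  assumes refl: "refl_causes P" "refl_causes Q"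
    and "realises P p u" "realises Q q v" "v \<noteq> []"
  shows "realises (pes_seq P Q) (p * q) (u @ v)"
proof -
  obtain ds where ds: "linearises P ds" "set ds \<in> max_configs P"
    "map (lab P) ds = u" "val P (set ds) = p"
    using assms by (auto simp: realises_def)
  obtain es where es: "linearises Q es" "set es \<in> max_configs Q"
    "map (lab Q) es = v" "val Q (set es) = q"
    using assms by (auto simp: realises_def)
  \<comment> \<open>The index of the copy to be entered: the maximal configuration linearised by
    \<open>ds\<close>, as a finite set.\<close>
  define z where "z = fset_of_list ds"
  have z: "fset z = set ds" by (simp add: z_def fset_of_list.rep_eq)
  define fs where "fs = map InL ds @ map (\<lambda>e. After e z) es"
  have set_fs: "set fs = InL ` fset z \<union> (\<lambda>e. After e z) ` set es"
    by (simp add: fs_def z)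
  have max: "set fs \<in> max_configs (pes_seq P Q)"
    unfolding set_fs by (rule seq_max_configI[OF refl]) (simp_all add: z ds es)
  have "distinct fs"
    using ds(1) es(1) by (auto simp: fs_def linearises_def distinct_map inj_on_def)
  moreover have "set us \<in> configs (pes_seq P Q)" if "fs = us @ vs" for us vs
  proof -
    \<comment> \<open>A prefix either stops within \<open>ds\<close> or includes all of it. Only in
      the second case do copied events occur, and then all their causes in the first component are
      present.\<close>
    from that consider ds1 ds2 where "ds = ds1 @ ds2" "us = map InL ds1"
      | es1 es2 where "es = es1 @ es2" "us = map InL ds @ map (\<lambda>e. After e z) es1"
      by (auto simp: fs_def append_eq_append_conv2 map_eq_append_conv)
    then show ?thesis
    proof cases
      case 1
      then show ?thesis using ds(1) by (auto simp: linearises_def intro!: seq_configI_first)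
    next
      case 2
      then have "set es1 \<in> configs Q" using es(1) by (auto simp: linearises_def)
      then show ?thesis using seq_configI[of z P "set es1" Q] 2 ds(2) z by simp
    qed
  qed
  ultimately have lin: "linearises (pes_seq P Q) fs"
    by (auto simp: linearises_def)
  have lab: "map (lab (pes_seq P Q)) fs = u @ v"
    using ds(3) es(3) by (auto simp: fs_def seq_sel)
  have vim: "InL -` set fs = set ds" "{e. \<exists>y. After e y \<in> set fs} = set es"
    using set_fs z by auto
  \<comment> \<open>Since \<open>v\<close> is nonempty, some copied event occurs and the product
    branch of the valuation applies.\<close>
  have "\<not> set fs \<subseteq> range InL"
    using set_fs es(3) assms(5) by (cases es) auto
  then have val: "val (pes_seq P Q) (set fs) = p * q"
    using seq_val[OF max_configs_configs[OF max]] vim ds(4) es(4) by simp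
  show ?thesis
    by (rule realisesI[OF lin max lab val])
qed

section \<open>From runs to covering chains\<close>

lemma run_realises: "run C p w \<Longrightarrow> realises (denot C) p w"
proof (induction C arbitrary: p w)
  case Skip
  then show ?case using run_Skip realises_single by fastforce
next
  case (Atom a)
  then show ?case using run_Atom realises_single by fastforce
next
  case (Seq C1 C2)
  then show ?case
    using run_Seq[OF Seq.prems] by (auto intro!: realises_seq refl_causes_denot dest: run_not_Nil)
next
  case (Choice q C1 C2)
  then show ?case
    using run_Choice[OF Choice.prems]
    by (auto intro!: realises_choice_left realises_choice_right dest: run_not_Nil)
next
  case (Par C1 C2)
  then show ?case
    using run_Par[OF Par.prems] by (auto intro!: realises_par)
qed

text \<open>The prefix of length \<open>i\<close> is the \<open>i\<close>-th configuration, and the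
  next prefix adds \<open>es ! i\<close>, which is new by distinctness.\<close>

lemma linearises_covering_chain:
  assumes "linearises P es"
  shows "covering_chain P (length es) (\<lambda>i. set (take i es)) (\<lambda>i. es ! i) (set es)"
proof -
  have "set (take i es) \<in> configs P" for i
    using assms append_take_drop_id[of i es] unfolding linearises_def by metis
  moreover have "es ! i \<notin> set (take i es)" if "i < length es" for i
    using assms that by (auto simp: linearises_def in_set_conv_nth nth_eq_iff_index_eq)
  ultimately show ?thesis
    by (auto simp: covering_chain_def take_Suc_conv_app_nth)
qed

theorem mainTheorem3:
  fixes C :: "'a cmd" and p0 :: real and w0 :: "'a label list"
    and R :: "('a label list, 'a) formal_sum"
  assumes "multi_step C (add_mset (p0, w0, Done) R)"
  shows "\<exists>x0 \<in> max_configs (denot C).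
           (\<exists>n x e. covering_chain (denot C) n x e x0 \<and> chain_labels (denot C) n e = w0) \<and>
           p0 = val (denot C) x0"
proof -
  have "run C p0 w0"
    using multi_step_Done_run[OF assms] by simp
  then obtain es where es: "linearises (denot C) es" "set es \<in> max_configs (denot C)"
    "map (lab (denot C)) es = w0" "val (denot C) (set es) = p0"
    using run_realises unfolding realises_def by blast
  have "chain_labels (denot C) (length es) (\<lambda>i. es ! i) = w0"
    unfolding chain_labels_def es(3)[symmetric] by (rule nth_equalityI) auto
  then show ?thesis
    using es linearises_covering_chain[OF es(1)] by blast
qed

end
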